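(* Fix a staggered mesh with periodic boundary conditions, $\Delta t>0$ and constants $c_0,c_h\in\mathbb{R}$, $\tau\in(0,+\infty]$, and let $(T_p^n,\mathbf{J}_c^n,\boldsymbol{\psi}_p^n,\varphi_c^n)_{n\ge0}$ satisfy the scheme $$T_p^{n+1}=T_p^n-c_0\Delta t\,\nabla_p^c\cdot\mathbf{J}_c^{n+\frac12},$$ $$\mathbf{J}_c^{n+1}=\mathbf{J}_c^n-c_0\Delta t\,\nabla_c^pT_p^{n+\frac12}-c_h\Delta t\,\nabla_c^p\times\boldsymbol{\psi}_p^{n+\frac12}-\frac{\Delta t}{\tau}\mathbf{J}_c^{n+\frac12},$$ $$\boldsymbol{\psi}_p^{n+1}=\boldsymbol{\psi}_p^n+c_h\Delta t\,\nabla_p^c\times\mathbf{J}_c^{n+\frac12}-c_h\Delta t\,\nabla_p^c\varphi_c^{n+\frac12},$$ $$\varphi_c^{n+1}=\varphi_c^n-c_h\Delta t\,\nabla_c^p\cdot\boldsymbol{\psi}_p^{n+\frac12}.$$ Let $$\mathrm{E}^n=\frac12\Big(\sum_p|\Omega_p|(T_p^n)^2+\sum_c|\Omega_c|\,\|\mathbf{J}_c^n\|^2+\sum_p|\Omega_p|\,\|\boldsymbol{\psi}_p^n\|^2+\sum_c|\Omega_c|(\varphi_c^n)^2\Big)$$ be the global discrete total energy. Then: (a) if $\tau<+\infty$, the energy is dissipated: $$\mathrm{E}^{n+1}-\mathrm{E}^n=-\frac{\Delta t}{\tau}\sum_c|\Omega_c|\,\big\|\mathbf{J}_c^{n+\frac12}\big\|^2\le0\qquad\forall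 n\ge0;$$ (b) in the absence of sources ($1/\tau=0$), the discrete total energy is exactly conserved: $\mathrm{E}^n=\mathrm{E}^0$ for all $n\ge0$.
   Context: Staggered mesh: the domain $\Omega$ is covered by finitely many primal cells $\Omega_c$ (indexed by $c$, centers $\mathbf{x}_c$) and by dual cells $\Omega_p$ (indexed by the primal vertices $p$, centers $\mathbf{x}_p$) obtained by connecting neighboring primal cell centers; $|\Omega_c|,|\Omega_p|>0$ are their measures. Write $p\in\Omega_c$ iff $p$ is a vertex of $\Omega_c$; this is equivalent to $c\in\Omega_p$. With periodic boundary conditions the mesh is identified periodically and there are no boundary contributions. For each incident pair $(c,p)$, $l_{pc}\mathbf{n}_{pc}$ is the corner vector: the integral of the unit normal outward to $\Omega_c$ over the part of $\partial\Omega_c$ consisting of the half-edges of $\Omega_c$ adjacent to $p$ (viewed as a vector in $\mathbb{R}^3$, with vanishing third component for two-dimensional meshes), with $l_{pc}\ge0$, and $\mathbf{n}_{cp}=-\mathbf{n}_{pc}$. One has $\sum_{p\in\Omega_c}l_{pc}\mathbf{n}_{pc}=0$ and $\sum_{c\in\Omega_p}l_{pc}\mathbf{n}_{cp}=0$. Discrete operators, for $\star$ denoting multiplication by a scalar field (gradient), scalar product $\cdot$ with a vector field (divergence), or vector product $\times$ with a vector field (curl): $$(\nabla_c^p\star f_p)_c=\frac1{|\Omega_c|}\sum_{p\in\Omega_c}l_{pc}\mathbf{n}_{pc}\star f_p,\qquad(\nabla_p^c\star f_c)_p=\frac1{|\Omega_p|}\sum_{c\in\Omega_p}l_{pc}\mathbf{n}_{cp}\star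 f_c.$$ Unknowns: $T_p^n\in\mathbb{R}$ and $\boldsymbol{\psi}_p^n\in\mathbb{R}^3$ live at the vertices $p$; $\mathbf{J}_c^n\in\mathbb{R}^3$ and $\varphi_c^n\in\mathbb{R}$ live at the cell centers $c$. A superscript $n+\frac12$ denotes the average of the values at $n$ and $n+1$. $\tau=+\infty$ ($1/\tau=0$) means the relaxation term is dropped (reversible scheme). $\|\cdot\|$ is the Euclidean norm. *)

theory Defs
  imports "HOL-Analysis.Analysis"
begin

section \<open>Periodic staggered meshes\<close>

text \<open>
  The type \<open>'a\<close> is the physical space, of dimension 2 or 3. A periodic mesh is represented by the
  periodic tessellation of the whole space that it generates: \<open>periods\<close> is the lattice of periods, and
  the indices \<open>'c\<close> and \<open>'p\<close> stand for cells and vertices modulo that lattice. \<open>cell\<close>, \<open>dual_cell\<close>,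
  \<open>ccenter\<close>, \<open>vpos\<close> choose one (closed) representative each. \<open>embed\<close> is the view of the physical space
  inside \<open>real ^ 3\<close>. The set \<open>half_edges M c p\<close> lists the flat pieces of the boundary of cell \<open>c\<close>
  attached to \<open>p\<close>; in two dimensions these are the half-edges (see \<open>half_edges_2d\<close> below), in three
  dimensions the pieces of the faces of the cell that are adjacent to \<open>p\<close>.
\<close>

record ('a, 'c, 'p) mesh =
  periods :: "'a set"
  embed :: "'a \<Rightarrow> real ^ 3"
  cells :: "'c set"
  verts :: "'p set"
  cell :: "'c \<Rightarrow> 'a set"
  dual_cell :: "'p \<Rightarrow> 'a set"
  ccenter :: "'c \<Rightarrow> 'a"
  vpos :: "'p \<Rightarrow> 'a"
  half_edges :: "'c \<Rightarrow> 'p \<Rightarrow> 'a set set"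

definition period_lattice :: "'a::euclidean_space set \<Rightarrow> bool" where
  "period_lattice L \<longleftrightarrow>
     (\<exists>B. independent B \<and> card B = DIM('a) \<and>
          L = range (\<lambda>k::'a \<Rightarrow> int. \<Sum>b\<in>B. of_int (k b) *\<^sub>R b))"

definition periodic_tessellation :: "'a::euclidean_space set \<Rightarrow> 'i set \<Rightarrow> ('i \<Rightarrow> 'a set) \<Rightarrow> bool" where
  "periodic_tessellation L I S \<longleftrightarrow>
     (\<Union>i\<in>I. \<Union>v\<in>L. (+) v ` S i) = UNIV \<and>
     (\<forall>i\<in>I. \<forall>j\<in>I. \<forall>u\<in>L. \<forall>v\<in>L. (i, u) \<noteq> (j, v) \<longrightarrow>
        interior ((+) u ` S i) \<inter> interior ((+) v ` S j) = {})"

definition copies :: "'a::euclidean_space set \<Rightarrow> 'a \<Rightarrow> 'a set" where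
  "copies L x = (\<lambda>v. v + x) ` L"

definition all_vertices :: "('a::euclidean_space, 'c, 'p) mesh \<Rightarrow> 'a set" where
  "all_vertices M = (\<Union>p\<in>verts M. copies (periods M) (vpos M p))"

text \<open>\<open>verts_of M c\<close> is \<open>{p. p \<in> \<Omega>\<^sub>c}\<close>: no vertex lies in the interior of a cell, so the mesh
  vertices contained in a closed cell are the vertices of that cell. Dually for \<open>cells_of M p\<close>.\<close>

definition verts_of :: "('a::euclidean_space, 'c, 'p) mesh \<Rightarrow> 'c \<Rightarrow> 'p set" where
  "verts_of M c = {p \<in> verts M. copies (periods M) (vpos M p) \<inter> cell M c \<noteq> {}}"

definition cells_of :: "('a::euclidean_space, 'c, 'p) mesh \<Rightarrow> 'p \<Rightarrow> 'c set" where
  "cells_of M p = {c \<in> cells M. copies (periods M) (ccenter M c) \<inter> dual_cell M p \<noteq> {}}"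

text \<open>\<open>is_edge\<close> is used for two-dimensional meshes only; \<open>S\<close> is a closed cell.\<close>

definition is_edge :: "('a::euclidean_space, 'c, 'p) mesh \<Rightarrow> 'a set \<Rightarrow> 'a \<Rightarrow> 'a \<Rightarrow> bool" where
  "is_edge M S y z \<longleftrightarrow>
     y \<in> all_vertices M \<and> z \<in> all_vertices M \<and> y \<noteq> z \<and>
     closed_segment y z \<subseteq> frontier S \<and> open_segment y z \<inter> all_vertices M = {}"

definition is_outward_normal :: "'a::euclidean_space set \<Rightarrow> 'a set \<Rightarrow> 'a \<Rightarrow> bool" where
  "is_outward_normal S h \<nu> \<longleftrightarrow>
     norm \<nu> = 1 \<and> (\<forall>x\<in>h. \<forall>y\<in>h. \<nu> \<bullet> (x - y) = 0) \<and>
     (\<forall>x\<in>rel_interior h. \<exists>e>0. \<forall>t. 0 < t \<and> t < e \<longrightarrow>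
        x + t *\<^sub>R \<nu> \<notin> S \<and> x - t *\<^sub>R \<nu> \<in> S)"

definition outward_normal :: "'a::euclidean_space set \<Rightarrow> 'a set \<Rightarrow> 'a" where
  "outward_normal S h = (THE \<nu>. is_outward_normal S h \<nu>)"

text \<open>The length (in 2D) or area (in 3D) of a flat piece \<open>h\<close> with unit normal \<open>\<nu>\<close> is the Lebesgue
  measure of the right prism of height 1 over \<open>h\<close>.\<close>

definition flat_measure :: "'a::euclidean_space set \<Rightarrow> 'a \<Rightarrow> real" where
  "flat_measure h \<nu> = measure lebesgue {x + t *\<^sub>R \<nu> | x t. x \<in> h \<and> 0 \<le> t \<and> t \<le> 1}"

text \<open>The outward normal is constant on each flat piece, so its integral over the part of the cell
  boundary attached to \<open>p\<close> is the following finite sum.\<close>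

definition corner_vector :: "('a::euclidean_space, 'c, 'p) mesh \<Rightarrow> 'c \<Rightarrow> 'p \<Rightarrow> real ^ 3" where
  "corner_vector M c p =
     embed M (\<Sum>h\<in>half_edges M c p.
       flat_measure h (outward_normal (cell M c) h) *\<^sub>R outward_normal (cell M c) h)"

text \<open>By \<open>norm x *\<^sub>R sgn x = x\<close>, the product \<open>l_pc M p c *\<^sub>R n_pc M p c\<close> is the corner vector.\<close>

definition l_pc :: "('a::euclidean_space, 'c, 'p) mesh \<Rightarrow> 'p \<Rightarrow> 'c \<Rightarrow> real" where
  "l_pc M p c = norm (corner_vector M c p)"

definition n_pc :: "('a::euclidean_space, 'c, 'p) mesh \<Rightarrow> 'p \<Rightarrow> 'c \<Rightarrow> real ^ 3" where
  "n_pc M p c = sgn (corner_vector M c p)"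

definition n_cp :: "('a::euclidean_space, 'c, 'p) mesh \<Rightarrow> 'c \<Rightarrow> 'p \<Rightarrow> real ^ 3" where
  "n_cp M c p = - n_pc M p c"

definition vol_c :: "('a::euclidean_space, 'c, 'p) mesh \<Rightarrow> 'c \<Rightarrow> real" where
  "vol_c M c = measure lebesgue (cell M c)"

definition vol_p :: "('a::euclidean_space, 'c, 'p) mesh \<Rightarrow> 'p \<Rightarrow> real" where
  "vol_p M p = measure lebesgue (dual_cell M p)"

locale staggered_mesh =
  fixes M :: "('a::euclidean_space, 'c, 'p) mesh"
  assumes dim: "DIM('a) = 2 \<or> DIM('a) = 3"
    and linear_embed: "linear (embed M)"
    and isometric_embed: "\<And>x. norm (embed M x) = norm x"
    and planar_embed: "\<And>x. DIM('a) = 2 \<Longrightarrow> embed M x $ 3 = 0"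
    and lattice: "period_lattice (periods M)"
    and finite_cells: "finite (cells M)"
    and finite_verts: "finite (verts M)"
    and compact_cell: "\<And>c. c \<in> cells M \<Longrightarrow> compact (cell M c)"
    and compact_dual_cell: "\<And>p. p \<in> verts M \<Longrightarrow> compact (dual_cell M p)"
    and vol_c_pos: "\<And>c. c \<in> cells M \<Longrightarrow> vol_c M c > 0"
    and vol_p_pos: "\<And>p. p \<in> verts M \<Longrightarrow> vol_p M p > 0"
    and cells_tessellate: "periodic_tessellation (periods M) (cells M) (cell M)"
    and dual_cells_tessellate: "periodic_tessellation (periods M) (verts M) (dual_cell M)"
    and ccenter_in_cell: "\<And>c. c \<in> cells M \<Longrightarrow> ccenter M c \<in> cell M c"
    and verts_distinct: "\<And>p q. p \<in> verts M \<Longrightarrow> q \<in> verts M \<Longrightarrow> p \<noteq> q \<Longrightarrow>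
          copies (periods M) (vpos M p) \<inter> copies (periods M) (vpos M q) = {}"
    and verts_not_interior: "\<And>c. c \<in> cells M \<Longrightarrow> all_vertices M \<inter> interior (cell M c) = {}"
    \<comment> \<open>\<open>p \<in> \<Omega>\<^sub>c\<close> if and only if \<open>c \<in> \<Omega>\<^sub>p\<close>, stated in the unfolded periodic tessellation\<close>
    and incidence: "\<And>c p v. c \<in> cells M \<Longrightarrow> p \<in> verts M \<Longrightarrow> v \<in> periods M \<Longrightarrow>
          vpos M p \<in> (+) v ` cell M c \<longleftrightarrow> v + ccenter M c \<in> dual_cell M p"
    \<comment> \<open>dual cells are obtained by connecting the centers of neighboring primal cells\<close>
    and dual_cell_hull: "\<And>p. p \<in> verts M \<Longrightarrow>
          dual_cell M p \<subseteq>
            convex hull {v + ccenter M c | v c. v \<in> periods M \<and> c \<in> cells M \<and> vpos M p \<in> (+) v ` cell M c}"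
    and dual_cell_2d: "\<And>p. DIM('a) = 2 \<Longrightarrow> p \<in> verts M \<Longrightarrow>
          frontier (dual_cell M p) =
            \<Union>{closed_segment (u + ccenter M c) (v + ccenter M d) | u v c d.
                u \<in> periods M \<and> v \<in> periods M \<and> c \<in> cells M \<and> d \<in> cells M \<and> (u, c) \<noteq> (v, d) \<and>
                (\<exists>z. is_edge M ((+) u ` cell M c) (vpos M p) z \<and>
                     is_edge M ((+) v ` cell M d) (vpos M p) z)}"
    \<comment> \<open>the boundary of each cell is cut into flat pieces attached to its vertices\<close>
    and finite_half_edges: "\<And>c p. c \<in> cells M \<Longrightarrow> p \<in> verts M \<Longrightarrow> finite (half_edges M c p)"
    and half_edge_flat: "\<And>c p h. c \<in> cells M \<Longrightarrow> p \<in> verts M \<Longrightarrow> h \<in> half_edges M c p \<Longrightarrow>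
          polytope h \<and> aff_dim h = int DIM('a) - 1 \<and> (\<exists>\<nu>. is_outward_normal (cell M c) h \<nu>)"
    and half_edge_adjacent: "\<And>c p h. c \<in> cells M \<Longrightarrow> p \<in> verts M \<Longrightarrow> h \<in> half_edges M c p \<Longrightarrow>
          copies (periods M) (vpos M p) \<inter> h \<noteq> {}"
    and half_edges_cover: "\<And>c. c \<in> cells M \<Longrightarrow>
          (\<Union>p\<in>verts M. \<Union>(half_edges M c p)) = frontier (cell M c)"
    and half_edges_nonoverlap: "\<And>c p q h k. c \<in> cells M \<Longrightarrow> p \<in> verts M \<Longrightarrow> q \<in> verts M \<Longrightarrow>
          h \<in> half_edges M c p \<Longrightarrow> k \<in> half_edges M c q \<Longrightarrow> (p, h) \<noteq> (q, k) \<Longrightarrow>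
          rel_interior h \<inter> rel_interior k = {}"
    and half_edges_2d: "\<And>c p. DIM('a) = 2 \<Longrightarrow> c \<in> cells M \<Longrightarrow> p \<in> verts M \<Longrightarrow>
          half_edges M c p =
            {closed_segment y (midpoint y z) | y z.
               y \<in> copies (periods M) (vpos M p) \<and> is_edge M (cell M c) y z}"
    and cell_closed: "\<And>c. c \<in> cells M \<Longrightarrow> (\<Sum>p\<in>verts_of M c. l_pc M p c *\<^sub>R n_pc M p c) = 0"
    and dual_cell_closed: "\<And>p. p \<in> verts M \<Longrightarrow> (\<Sum>c\<in>cells_of M p. l_pc M p c *\<^sub>R n_cp M c p) = 0"

section \<open>Discrete operators and energy\<close>

text \<open>The product \<open>\<star>\<close> is the first explicit argument of the generic operators: a vector from
  \<open>real ^ 3\<close> on the left, a field value on the right.\<close>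

definition nabla_c ::
  "('a::euclidean_space, 'c, 'p) mesh \<Rightarrow> (real ^ 3 \<Rightarrow> 'f \<Rightarrow> 'g::real_vector) \<Rightarrow> ('p \<Rightarrow> 'f) \<Rightarrow> 'c \<Rightarrow> 'g" where
  "nabla_c M star f c =
     (1 / vol_c M c) *\<^sub>R (\<Sum>p\<in>verts_of M c. star (l_pc M p c *\<^sub>R n_pc M p c) (f p))"

definition nabla_p ::
  "('a::euclidean_space, 'c, 'p) mesh \<Rightarrow> (real ^ 3 \<Rightarrow> 'f \<Rightarrow> 'g::real_vector) \<Rightarrow> ('c \<Rightarrow> 'f) \<Rightarrow> 'p \<Rightarrow> 'g" where
  "nabla_p M star f p =
     (1 / vol_p M p) *\<^sub>R (\<Sum>c\<in>cells_of M p. star (l_pc M p c *\<^sub>R n_cp M c p) (f c))"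

abbreviation "grad_c M \<equiv> nabla_c M (\<lambda>a s. s *\<^sub>R a)"
abbreviation "div_c M \<equiv> nabla_c M (\<lambda>a b. a \<bullet> b)"
abbreviation "curl_c M \<equiv> nabla_c M cross3"
abbreviation "grad_p M \<equiv> nabla_p M (\<lambda>a s. s *\<^sub>R a)"
abbreviation "div_p M \<equiv> nabla_p M (\<lambda>a b. a \<bullet> b)"
abbreviation "curl_p M \<equiv> nabla_p M cross3"

definition half_step :: "(nat \<Rightarrow> 'i \<Rightarrow> 'v::real_vector) \<Rightarrow> nat \<Rightarrow> 'i \<Rightarrow> 'v" where
  "half_step u n i = (1 / 2) *\<^sub>R (u n i + u (Suc n) i)"

definition total_energy ::
  "('a::euclidean_space, 'c, 'p) mesh \<Rightarrow> (nat \<Rightarrow> 'p \<Rightarrow> real) \<Rightarrow> (nat \<Rightarrow> 'c \<Rightarrow> real ^ 3) \<Rightarrow>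
   (nat \<Rightarrow> 'p \<Rightarrow> real ^ 3) \<Rightarrow> (nat \<Rightarrow> 'c \<Rightarrow> real) \<Rightarrow> nat \<Rightarrow> real" where
  "total_energy M T J \<psi> \<phi> n =
     1 / 2 * ((\<Sum>p\<in>verts M. vol_p M p * (T n p)\<^sup>2) + (\<Sum>c\<in>cells M. vol_c M c * (norm (J n c))\<^sup>2)
            + (\<Sum>p\<in>verts M. vol_p M p * (norm (\<psi> n p))\<^sup>2) + (\<Sum>c\<in>cells M. vol_c M c * (\<phi> n c)\<^sup>2))"

text \<open>\<open>1 / \<tau>\<close> for a relaxation time \<open>0 < \<tau> \<le> \<infinity>\<close>, with \<open>1 / \<infinity> = 0\<close>.\<close>

definition relax_rate :: "ereal \<Rightarrow> real" where
  "relax_rate \<tau> = real_of_ereal (1 / \<tau>)"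

end

theory Submission
  imports Defs
begin

text \<open>
  Because incidence of cells and vertices is symmetric and \<open>n_cp = - n_pc\<close>, exchanging the order of
  summation shows that the primal and the dual discrete operators are adjoint to each other up to
  sign, with respect to the scalar products weighted by the cell measures. Since
  \<open>(|u'|\<^sup>2 - |u|\<^sup>2) / 2 = (u' - u) \<bullet> (u + u') / 2\<close>, testing each equation of the scheme with the
  corresponding half-step value gives the energy balance, in which the adjoint terms cancel and
  only the relaxation term survives.
\<close>

text \<open>Negating the integer coefficients of a period gives its negative. This permits reversing
  translations when vertices and cells are compared.\<close>

lemma period_lattice_uminus:
  assumes "period_lattice L" "v \<in> L"
  shows "- v \<in> L"
proof -
  obtain B where L: "L = range (\<lambda>k::'a \<Rightarrow> int. \<Sum>b\<in>B. of_int (k b) *\<^sub>R b)"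
    using assms(1) unfolding period_lattice_def by blast
  obtain k :: "'a \<Rightarrow> int" where "v = (\<Sum>b\<in>B. of_int (k b) *\<^sub>R b)"
    using assms(2) L by blast
  then have "- v = (\<Sum>b\<in>B. of_int (- k b) *\<^sub>R b)"
    by (simp add: sum_negf)
  then show ?thesis
    unfolding L by (intro image_eqI[where x = "\<lambda>b. - k b"]) auto
qed

context staggered_mesh
begin

lemma verts_of_iff_cells_of:
  assumes c: "c \<in> cells M" and p: "p \<in> verts M"
  shows "p \<in> verts_of M c \<longleftrightarrow> c \<in> cells_of M p"
proof -
  have neg: "- v \<in> periods M" if "v \<in> periods M" for v
    using period_lattice_uminus[OF lattice that] .
  have "p \<in> verts_of M c \<longleftrightarrow> (\<exists>v\<in>periods M. v + vpos M p \<in> cell M c)"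
    using p by (auto simp: verts_of_def copies_def)
  \<comment> \<open>\<open>verts_of\<close> translates the vertex, whereas \<open>incidence\<close>
    translates the cell. Reindexing the lattice by \<open>v \<mapsto> - v\<close> passes from one to
    the other.\<close>
  also have "\<dots> \<longleftrightarrow> (\<exists>v\<in>periods M. - v + vpos M p \<in> cell M c)"
    by (metis neg minus_minus)
  also have "\<dots> \<longleftrightarrow> (\<exists>v\<in>periods M. vpos M p \<in> (+) v ` cell M c)"
    by (intro bex_cong refl) (force simp: image_iff algebra_simps)
  also have "\<dots> \<longleftrightarrow> (\<exists>v\<in>periods M. v + ccenter M c \<in> dual_cell M p)"
    using incidence[OF c p] by blast
  also have "\<dots> \<longleftrightarrow> c \<in> cells_of M p"
    using c by (auto simp: cells_of_def copies_def)
  finally show ?thesis .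
qed

text \<open>Both sides run over the same finite set of incident pairs, by
  \<open>verts_of_iff_cells_of\<close>.\<close>

lemma sum_corners_swap:
  "(\<Sum>c\<in>cells M. \<Sum>p\<in>verts_of M c. h c p) = (\<Sum>p\<in>verts M. \<Sum>c\<in>cells_of M p. h c p)"
proof -
  \<comment> \<open>The inner index set becomes a filter of \<open>verts M\<close>, the shape that
    \<open>sum.swap_restrict\<close> expects.\<close>
  have "(\<Sum>c\<in>cells M. \<Sum>p\<in>verts_of M c. h c p)
      = (\<Sum>c\<in>cells M. \<Sum>p | p \<in> verts M \<and> c \<in> cells_of M p. h c p)"
    using verts_of_iff_cells_of by (intro sum.cong) (auto simp: verts_of_def)
  also have "\<dots> = (\<Sum>p\<in>verts M. \<Sum>c | c \<in> cells M \<and> c \<in> cells_of M p. h c p)"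
    by (rule sum.swap_restrict[OF finite_cells finite_verts])
  also have "\<dots> = (\<Sum>p\<in>verts M. \<Sum>c\<in>cells_of M p. h c p)"
    by (intro sum.cong) (auto simp: cells_of_def)
  finally show ?thesis .
qed

text \<open>One summation by parts for all three pairs of operators: \<open>s\<close> is -1 for
  gradient and divergence, 1 for the curl. The argument \<open>- a\<close> of \<open>star'\<close>
  reflects that the dual operator uses the opposite normal.\<close>

lemma nabla_adjoint:
  fixes star :: "real ^ 3 \<Rightarrow> 'f::real_inner \<Rightarrow> 'g::real_inner"
  assumes adj: "\<And>a x y. star a x \<bullet> y = s * (x \<bullet> star' (- a) y)"
  shows "(\<Sum>c\<in>cells M. vol_c M c * (nabla_c M star f c \<bullet> g c))
       = s * (\<Sum>p\<in>verts M. vol_p M p * (f p \<bullet> nabla_p M star' g p))"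
proof -
  \<comment> \<open>The positive weight cancels the factor \<open>1 / vol_c M c\<close> of the
    operator.\<close>
  have "(\<Sum>c\<in>cells M. vol_c M c * (nabla_c M star f c \<bullet> g c))
      = (\<Sum>c\<in>cells M. \<Sum>p\<in>verts_of M c. star (l_pc M p c *\<^sub>R n_pc M p c) (f p) \<bullet> g c)"
    using vol_c_pos by (intro sum.cong) (auto simp: nabla_c_def inner_sum_left less_imp_neq[symmetric])
  also have "\<dots> = (\<Sum>p\<in>verts M. \<Sum>c\<in>cells_of M p. star (l_pc M p c *\<^sub>R n_pc M p c) (f p) \<bullet> g c)"
    by (rule sum_corners_swap)
  \<comment> \<open>With \<open>a\<close> the corner vector, \<open>- a\<close> is
    \<open>l_pc M p c *\<^sub>R n_cp M c p\<close>. The factor \<open>vol_p M p\<close> compensates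
    the division in \<open>nabla_p\<close>.\<close>
  also have "\<dots> = (\<Sum>p\<in>verts M. s * (vol_p M p * (f p \<bullet> nabla_p M star' g p)))"
    using vol_p_pos
    by (intro sum.cong)
       (auto simp: adj n_cp_def nabla_p_def inner_sum_right sum_distrib_left less_imp_neq[symmetric])
  finally show ?thesis
    by (simp add: sum_distrib_left)
qed

lemma grad_c_adjoint:
  "(\<Sum>c\<in>cells M. vol_c M c * (grad_c M f c \<bullet> g c)) = - (\<Sum>p\<in>verts M. vol_p M p * (f p * div_p M g p))"
  using nabla_adjoint[of "\<lambda>a s. s *\<^sub>R a" "-1" "\<lambda>a b. a \<bullet> b" f g] by simp

lemma div_c_adjoint:
  "(\<Sum>c\<in>cells M. vol_c M c * (div_c M f c * g c)) = - (\<Sum>p\<in>verts M. vol_p M p * (f p \<bullet> grad_p M g p))"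
  using nabla_adjoint[of "\<lambda>a b. a \<bullet> b" "-1" "\<lambda>a s. s *\<^sub>R a" f g] by (simp add: inner_commute mult.commute)

lemma curl_c_adjoint:
  "(\<Sum>c\<in>cells M. vol_c M c * (curl_c M f c \<bullet> g c)) = (\<Sum>p\<in>verts M. vol_p M p * (f p \<bullet> curl_p M g p))"
proof -
  \<comment> \<open>Cyclic invariance of the triple product gives one sign from antisymmetry, which
    \<open>- a\<close> absorbs; hence no sign remains.\<close>
  have "cross3 a x \<bullet> y = 1 * (x \<bullet> cross3 (- a) y)" for a x y
    by (simp add: cross3_simps)
  from nabla_adjoint[of cross3, OF this] show ?thesis
    by simp
qed

end

text \<open>The mixed terms cancel by symmetry of the inner product; this is where the midpoint
  value is essential.\<close>

lemma half_norm_power2_diff: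
  fixes u :: "nat \<Rightarrow> 'i \<Rightarrow> 'v::real_inner"
  shows "((norm (u (Suc n) i))\<^sup>2 - (norm (u n i))\<^sup>2) / 2 = (u (Suc n) i - u n i) \<bullet> half_step u n i"
  by (simp add: half_step_def power2_norm_eq_inner inner_diff_left inner_diff_right inner_add_right inner_commute field_simps)

lemma total_energy_diff:
  "total_energy M T J \<psi> \<phi> (Suc n) - total_energy M T J \<psi> \<phi> n =
     (\<Sum>p\<in>verts M. vol_p M p * ((T (Suc n) p - T n p) * half_step T n p))
   + (\<Sum>c\<in>cells M. vol_c M c * ((J (Suc n) c - J n c) \<bullet> half_step J n c))
   + (\<Sum>p\<in>verts M. vol_p M p * ((\<psi> (Suc n) p - \<psi> n p) \<bullet> half_step \<psi> n p))
   + (\<Sum>c\<in>cells M. vol_c M c * ((\<phi> (Suc n) c - \<phi> n c) * half_step \<phi> n c))"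
proof -
  \<comment> \<open>On the reals the inner product is multiplication, so the scalar fields are a
    special case.\<close>
  have scalar: "(a (Suc n) i - a n i) * half_step a n i = ((a (Suc n) i)\<^sup>2 - (a n i)\<^sup>2) / 2"
    for a :: "nat \<Rightarrow> 'i \<Rightarrow> real" and i
    using half_norm_power2_diff[of a n i] by simp
  show ?thesis
    unfolding total_energy_def scalar half_norm_power2_diff[symmetric]
    by (simp add: sum_subtractf right_diff_distrib diff_divide_distrib add_divide_distrib flip: sum_divide_distrib)
qed

text \<open>A single step with an arbitrary damping coefficient \<open>r\<close>, so that finite and
  infinite \<tau> are treated together.\<close>

lemma (in staggered_mesh) total_energy_balance:
  assumes "\<And>p. p \<in> verts M \<Longrightarrow>
        T (Suc n) p = T n p - c0 * dt * div_p M (half_step J n) p"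
    and "\<And>c. c \<in> cells M \<Longrightarrow>
        J (Suc n) c = J n c - (c0 * dt) *\<^sub>R grad_c M (half_step T n) c
                            - (ch * dt) *\<^sub>R curl_c M (half_step \<psi> n) c
                            - r *\<^sub>R half_step J n c"
    and "\<And>p. p \<in> verts M \<Longrightarrow>
        \<psi> (Suc n) p = \<psi> n p + (ch * dt) *\<^sub>R curl_p M (half_step J n) p
                            - (ch * dt) *\<^sub>R grad_p M (half_step \<phi> n) p"
    and "\<And>c. c \<in> cells M \<Longrightarrow>
        \<phi> (Suc n) c = \<phi> n c - ch * dt * div_c M (half_step \<psi> n) c"
  shows "total_energy M T J \<psi> \<phi> (Suc n) - total_energy M T J \<psi> \<phi> n
       = - r * (\<Sum>c\<in>cells M. vol_c M c * (norm (half_step J n c))\<^sup>2)"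
proof -
  have T: "(\<Sum>p\<in>verts M. vol_p M p * ((T (Suc n) p - T n p) * half_step T n p))
      = - (c0 * dt) * (\<Sum>p\<in>verts M. vol_p M p * (half_step T n p * div_p M (half_step J n) p))"
    unfolding sum_distrib_left by (intro sum.cong) (simp_all add: assms(1) algebra_simps)
  have J: "(\<Sum>c\<in>cells M. vol_c M c * ((J (Suc n) c - J n c) \<bullet> half_step J n c))
      = - (c0 * dt) * (\<Sum>c\<in>cells M. vol_c M c * (grad_c M (half_step T n) c \<bullet> half_step J n c))
        - ch * dt * (\<Sum>c\<in>cells M. vol_c M c * (curl_c M (half_step \<psi> n) c \<bullet> half_step J n c))
        - r * (\<Sum>c\<in>cells M. vol_c M c * (norm (half_step J n c))\<^sup>2)"
    unfolding sum_distrib_left sum_subtractf[symmetric]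
    by (intro sum.cong) (simp_all add: assms(2) power2_norm_eq_inner inner_diff_left algebra_simps)
  have \<psi>: "(\<Sum>p\<in>verts M. vol_p M p * ((\<psi> (Suc n) p - \<psi> n p) \<bullet> half_step \<psi> n p))
      = ch * dt * (\<Sum>p\<in>verts M. vol_p M p * (half_step \<psi> n p \<bullet> curl_p M (half_step J n) p))
        - ch * dt * (\<Sum>p\<in>verts M. vol_p M p * (half_step \<psi> n p \<bullet> grad_p M (half_step \<phi> n) p))"
    unfolding sum_distrib_left sum_subtractf[symmetric]
    by (intro sum.cong) (simp_all add: assms(3) inner_diff_left inner_commute algebra_simps)
  have \<phi>: "(\<Sum>c\<in>cells M. vol_c M c * ((\<phi> (Suc n) c - \<phi> n c) * half_step \<phi> n c))
      = - (ch * dt) * (\<Sum>c\<in>cells M. vol_c M c * (div_c M (half_step \<psi> n) c * half_step \<phi> n c))"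
    unfolding sum_distrib_left by (intro sum.cong) (simp_all add: assms(4) algebra_simps)
  \<comment> \<open>The adjoint identities move every coupling term to the vertices. There the
    \<open>c0\<close> terms of \<open>T\<close> and \<open>J\<close> cancel, as do the curl terms of
    \<open>J\<close> and \<open>\<psi>\<close> and the \<open>ch\<close> terms of
    \<open>\<psi>\<close> and \<open>\<phi>\<close>.\<close>
  show ?thesis
    unfolding total_energy_diff T J \<psi> \<phi> grad_c_adjoint curl_c_adjoint div_c_adjoint by simp
qed

theorem theorem4p2:
  fixes M :: "('a::euclidean_space, 'c, 'p) mesh"
    and dt c0 ch :: real
    and \<tau> :: ereal
    and T :: "nat \<Rightarrow> 'p \<Rightarrow> real"
    and J :: "nat \<Rightarrow> 'c \<Rightarrow> real ^ 3"
    and \<psi> :: "nat \<Rightarrow> 'p \<Rightarrow> real ^ 3"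
    and \<phi> :: "nat \<Rightarrow> 'c \<Rightarrow> real"
  assumes mesh: "staggered_mesh M"
    and dt: "dt > 0"
    and tau: "0 < \<tau>"
    and scheme_T: "\<And>n p. p \<in> verts M \<Longrightarrow>
          T (Suc n) p = T n p - c0 * dt * div_p M (half_step J n) p"
    and scheme_J: "\<And>n c. c \<in> cells M \<Longrightarrow>
          J (Suc n) c = J n c - (c0 * dt) *\<^sub>R grad_c M (half_step T n) c
                              - (ch * dt) *\<^sub>R curl_c M (half_step \<psi> n) c
                              - (dt * relax_rate \<tau>) *\<^sub>R half_step J n c"
    and scheme_psi: "\<And>n p. p \<in> verts M \<Longrightarrow>
          \<psi> (Suc n) p = \<psi> n p + (ch * dt) *\<^sub>R curl_p M (half_step J n) p
                              - (ch * dt) *\<^sub>R grad_p M (half_step \<phi> n) p"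
    and scheme_phi: "\<And>n c. c \<in> cells M \<Longrightarrow>
          \<phi> (Suc n) c = \<phi> n c - ch * dt * div_c M (half_step \<psi> n) c"
  shows "(\<tau> < \<infinity> \<longrightarrow>
            (\<forall>n. total_energy M T J \<psi> \<phi> (Suc n) - total_energy M T J \<psi> \<phi> n
                   = - (dt / real_of_ereal \<tau>) * (\<Sum>c\<in>cells M. vol_c M c * (norm (half_step J n c))\<^sup>2)
               \<and> - (dt / real_of_ereal \<tau>) * (\<Sum>c\<in>cells M. vol_c M c * (norm (half_step J n c))\<^sup>2) \<le> 0))
       \<and> (\<tau> = \<infinity> \<longrightarrow> (\<forall>n. total_energy M T J \<psi> \<phi> n = total_energy M T J \<psi> \<phi> 0))"
proof -
  interpret staggered_mesh M by (fact mesh)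
  have balance: "total_energy M T J \<psi> \<phi> (Suc n) - total_energy M T J \<psi> \<phi> n
      = - (dt * relax_rate \<tau>) * (\<Sum>c\<in>cells M. vol_c M c * (norm (half_step J n c))\<^sup>2)" for n
    by (rule total_energy_balance) (fact scheme_T scheme_J scheme_psi scheme_phi)+
  show ?thesis
  proof (intro conjI impI allI)
    fix n
    assume "\<tau> < \<infinity>"
    \<comment> \<open>Positivity excludes \<open>- \<infinity>\<close>, so \<tau> is a positive real
      and \<open>relax_rate \<tau>\<close> is its ordinary reciprocal.\<close>
    then obtain r where r: "\<tau> = ereal r" "0 < r"
      using tau by (cases \<tau>) auto
    then show "total_energy M T J \<psi> \<phi> (Suc n) - total_energy M T J \<psi> \<phi> n
        = - (dt / real_of_ereal \<tau>) * (\<Sum>c\<in>cells M. vol_c M c * (norm (half_step J n c))\<^sup>2)"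
      by (simp add: balance relax_rate_def one_ereal_def)
    have "0 \<le> (\<Sum>c\<in>cells M. vol_c M c * (norm (half_step J n c))\<^sup>2)"
      using vol_c_pos by (intro sum_nonneg mult_nonneg_nonneg) (auto intro: less_imp_le)
    then show "- (dt / real_of_ereal \<tau>) * (\<Sum>c\<in>cells M. vol_c M c * (norm (half_step J n c))\<^sup>2) \<le> 0"
      using dt r by simp
  next
    fix n
    assume "\<tau> = \<infinity>"
    \<comment> \<open>Since \<open>1 / \<infinity> = 0\<close> in \<open>ereal\<close>, the damping
      coefficient vanishes.\<close>
    then have "total_energy M T J \<psi> \<phi> (Suc n) = total_energy M T J \<psi> \<phi> n" for n
      using balance[of n] by (simp add: relax_rate_def)
    then show "total_energy M T J \<psi> \<phi> n = total_energy M T J \<psi> \<phi> 0"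
      by (induction n) simp_all
  qed
qed

end
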